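(* Let $\Sigma$ be an ordered alphabet with $|\Sigma|=3$. There are only finitely many $M$-equivalence classes over $\Sigma$ such that all words in the class are square-free. Furthermore, every such class is a $1$-equivalence class.
   Context: Write $\Sigma=\{a<b<c\}$. For words $w,v$, $|w|_v$ is the number of occurrences of $v$ as a scattered subword of $w$. A word is square-free if it has no factor (contiguous subword) of the form $uu$ with $u$ nonempty. The Parikh matrix of $w$ with respect to $a<b<c$ is the $4\times4$ upper triangular matrix with unit diagonal whose entries above the diagonal are: $(1,2)=|w|_a$, $(1,3)=|w|_{ab}$, $(1,4)=|w|_{abc}$, $(2,3)=|w|_b$, $(2,4)=|w|_{bc}$, $(3,4)=|w|_c$. Two words are $M$-equivalent iff they have the same Parikh matrix; the $M$-equivalence classes are the equivalence classes of this relation. A word $w$ is $1$-equivalent to $w'$ iff $w'$ can be obtained from $w$ by finitely many applications of the rule: replace a factor $ac$ by $ca$ or a factor $ca$ by $ac$ (i.e. $xacy\leftrightarrow xcay$ for words $x,y$); a $1$-equivalence class is an equivalence class of this relation. *)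

theory Defs
  imports "HOL-Library.Sublist" "Jordan_Normal_Form.Matrix"
begin

text \<open>An occurrence of \<open>v\<close> as a scattered subword of \<open>w\<close> is a set of positions of \<open>w\<close>
  at which \<open>v\<close> is read off.\<close>

definition subword_count :: "'a list \<Rightarrow> 'a list \<Rightarrow> nat" where
  "subword_count w v = card {I. I \<subseteq> {..<length w} \<and> nths w I = v}"

definition square_free :: "'a list \<Rightarrow> bool" where
  "square_free w \<longleftrightarrow> \<not> (\<exists>u. u \<noteq> [] \<and> sublist (u @ u) w)"

definition parikh_matrix :: "'a \<Rightarrow> 'a \<Rightarrow> 'a \<Rightarrow> 'a list \<Rightarrow> nat mat" where
  "parikh_matrix a b c w = mat_of_rows_list 4
     [[1, subword_count w [a], subword_count w [a, b], subword_count w [a, b, c]],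
      [0, 1,                   subword_count w [b],    subword_count w [b, c]],
      [0, 0,                   1,                      subword_count w [c]],
      [0, 0,                   0,                      1]]"

definition M_equiv :: "'a \<Rightarrow> 'a \<Rightarrow> 'a \<Rightarrow> ('a list \<times> 'a list) set" where
  "M_equiv a b c = {(w, w'). w \<in> lists {a, b, c} \<and> w' \<in> lists {a, b, c} \<and>
     parikh_matrix a b c w = parikh_matrix a b c w'}"

definition ac_swap :: "'a \<Rightarrow> 'a \<Rightarrow> ('a list \<times> 'a list) set" where
  "ac_swap a c = {(w, w'). \<exists>x y.
     (w = x @ [a, c] @ y \<and> w' = x @ [c, a] @ y) \<or>
     (w = x @ [c, a] @ y \<and> w' = x @ [a, c] @ y)}"

definition one_equiv :: "'a \<Rightarrow> 'a \<Rightarrow> 'a \<Rightarrow> ('a list \<times> 'a list) set" where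
  "one_equiv a b c = {(w, w'). w \<in> lists {a, b, c} \<and> w' \<in> lists {a, b, c} \<and>
     (w, w') \<in> (ac_swap a c)\<^sup>*}"

end

theory Submission imports Defs begin

text \<open>
  Call a word \<^emph>\<open>robust\<close> if every word reachable from it by swaps of adjacent \<open>a\<close> and \<open>c\<close>
  is square-free. Swaps preserve the Parikh matrix, so all words of a square-free
  \<open>M\<close>-equivalence class are robust. Already robustness bounds the length: between consecutive
  \<open>b\<close>s the letters can be sorted, and only 45 sorted words avoid squares up to swaps. These 45
  words have pairwise distinct Parikh matrices, so two \<open>M\<close>-equivalent robust words
  have the same sorted form and are \<open>1\<close>-equivalent.
\<close>

subsection \<open>Counting scattered subwords\<close>

lemma finite_occurrences: "finite {I. I \<subseteq> {..<n::nat} \<and> P I}"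
  by (rule finite_subset[of _ "Pow {..<n}"]) auto

lemma subword_count_Nil [simp]: "subword_count w [] = 1"
proof -
  have "{I. I \<subseteq> {..<length w} \<and> nths w I = []} = {{}}"
  proof -
    have "I = {}" if "I \<subseteq> {..<length w}" "nths w I = []" for I
    proof -
      have "set (nths w I) = {}" using that by simp
      then show ?thesis using that(1) by (auto simp: set_nths)
    qed
    then show ?thesis by auto
  qed
  then show ?thesis by (simp add: subword_count_def)
qed

lemma subword_count_Nil_Cons [simp]: "subword_count [] (y # v) = 0"
  by (simp add: subword_count_def)

text \<open>An occurrence either skips position 0 or uses it, and the latter forces
  \<open>x = y\<close>; all other positions shift by one. The recursion lets the simplifier evaluate
  counts on explicit words.\<close>

lemma subword_count_Cons_Cons [simp]:
  "subword_count (x # w) (y # v) =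
     subword_count w (y # v) + (if x = y then subword_count w v else 0)"
proof -
  define S where "S w v = {I. I \<subseteq> {..<length w} \<and> nths w I = v}" for w v :: "'a list"
  have fin: "finite (S w v)" for w v
    unfolding S_def by (rule finite_occurrences)
  let ?skip = "\<lambda>I. Suc ` I" and ?use = "\<lambda>I. insert 0 (Suc ` I)"
  have inj_skip: "inj_on ?skip A" for A
    by (auto intro!: inj_onI simp: inj_image_eq_iff)
  have inj_use: "inj_on ?use A" for A
  proof (rule inj_onI)
    fix I J :: "nat set" assume "?use I = ?use J"
    then have "?skip I = ?skip J"
      by (metis Diff_insert_absorb image_iff nat.distinct(1))
    then show "I = J" by (simp add: inj_image_eq_iff)
  qed
  \<comment> \<open>\<open>nths_Cons\<close> describes the positions in the tail by such preimages
    under \<open>Suc\<close>.\<close>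
  have pre_skip: "{j. Suc j \<in> Suc ` I} = I" "{j. Suc j \<in> insert 0 (Suc ` I)} = I" for I by auto
  have split: "S (x # w) (y # v) = ?skip ` S w (y # v) \<union> (if x = y then ?use ` S w v else {})"
  proof (intro equalityI subsetI)
    fix I assume I: "I \<in> S (x # w) (y # v)"
    define J where "J = {j. Suc j \<in> I}"
    have I_eq: "I = (if 0 \<in> I then ?use J else ?skip J)"
    proof (rule Set.set_eqI)
      fix i show "i \<in> I \<longleftrightarrow> i \<in> (if 0 \<in> I then ?use J else ?skip J)"
        by (cases i) (auto simp: J_def)
    qed
    have J: "J \<subseteq> {..<length w}" using I by (auto simp: S_def J_def)
    have n: "(if 0 \<in> I then [x] else []) @ nths w J = y # v"
      using I by (simp add: S_def nths_Cons J_def)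
    show "I \<in> ?skip ` S w (y # v) \<union> (if x = y then ?use ` S w v else {})"
      using I_eq J n by (cases "0 \<in> I") (auto simp: S_def)
  next
    fix I assume "I \<in> ?skip ` S w (y # v) \<union> (if x = y then ?use ` S w v else {})"
    then show "I \<in> S (x # w) (y # v)"
      by (auto simp: S_def nths_Cons pre_skip split: if_splits)
  qed
  have "card (S (x # w) (y # v)) = card (S w (y # v)) + (if x = y then card (S w v) else 0)"
    unfolding split using fin
    by (subst card_Un_disjoint) (auto simp: card_image inj_skip inj_use)
  then show ?thesis by (simp add: subword_count_def S_def)
qed

text \<open>Reading both swapped positions would make \<open>a\<close> and \<open>c\<close>
  neighbours in \<open>v\<close>, which is excluded; an occurrence using at most one of them moves
  along with its letter. The induction varies \<open>v\<close> because the recursion may consume its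
  head.\<close>

lemma subword_count_swap:
  assumes "a \<noteq> c" "\<not> sublist [a, c] v" "\<not> sublist [c, a] v"
  shows "subword_count (x @ a # c # y) v = subword_count (x @ c # a # y) v"
  using assms(2,3)
proof (induction x arbitrary: v)
  case Nil
  show ?case
  proof (cases v)
    case (Cons z v')
    then show ?thesis using Nil assms(1) by (cases v') (auto simp: sublist_Cons_right)
  qed simp
next
  case (Cons z x)
  then show ?case by (cases v) (auto simp: sublist_Cons_right)
qed

text \<open>The matrix entries that depend on the word, as a flat list, so that equality of matrices
  becomes a comparison the simplifier can decide.\<close>

definition parikh_vector :: "'a \<Rightarrow> 'a \<Rightarrow> 'a \<Rightarrow> 'a list \<Rightarrow> nat list" where
  "parikh_vector a b c w =
     map (subword_count w) [[a], [b], [c], [a, b], [b, c], [a, b, c]]"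

lemma parikh_matrix_eq_iff:
  "parikh_matrix a b c w = parikh_matrix a b c w' \<longleftrightarrow>
     parikh_vector a b c w = parikh_vector a b c w'" (is "?M = ?M' \<longleftrightarrow> _")
proof
  assume eq: "?M = ?M'"
  have "?M $$ (i, j) = ?M' $$ (i, j)" for i j by (simp add: eq)
  from this[of 0 1] this[of 0 2] this[of 0 3] this[of 1 2] this[of 1 3] this[of 2 3]
  show "parikh_vector a b c w = parikh_vector a b c w'"
    by (simp add: parikh_matrix_def parikh_vector_def mat_of_rows_list_def)
next
  assume "parikh_vector a b c w = parikh_vector a b c w'"
  then show "?M = ?M'" by (simp add: parikh_matrix_def parikh_vector_def)
qed

subsection \<open>Swaps\<close>

lemma ac_swap_rtrancl_context:
  "(w, w') \<in> (ac_swap a c)\<^sup>* \<Longrightarrow> (p @ w @ s, p @ w' @ s) \<in> (ac_swap a c)\<^sup>*"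
proof (induction rule: rtrancl_induct)
  case (step u v)
  then obtain x y where
    "u = x @ [a, c] @ y \<and> v = x @ [c, a] @ y \<or> u = x @ [c, a] @ y \<and> v = x @ [a, c] @ y"
    by (auto simp: ac_swap_def)
  then have "(p @ u @ s, p @ v @ s) \<in> ac_swap a c"
    unfolding ac_swap_def mem_Collect_eq case_prod_conv
    by (intro exI[of _ "p @ x"] exI[of _ "y @ s"]) auto
  with step.IH show ?case by (rule rtrancl_into_rtrancl)
qed simp

lemma ac_swap_rtrancl_sym: "(w, w') \<in> (ac_swap a c)\<^sup>* \<Longrightarrow> (w', w) \<in> (ac_swap a c)\<^sup>*"
proof -
  have "sym (ac_swap a c)" by (auto simp: sym_def ac_swap_def)
  then show "(w, w') \<in> (ac_swap a c)\<^sup>* \<Longrightarrow> (w', w) \<in> (ac_swap a c)\<^sup>*"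
    by (rule symD[OF sym_rtrancl])
qed

lemma ca_swap: "(p @ [c, a] @ s, p @ [a, c] @ s) \<in> (ac_swap a c)\<^sup>*"
  unfolding ac_swap_def by (rule r_into_rtrancl) blast

lemma ac_swap_rtrancl_set:
  "(w, w') \<in> (ac_swap a c)\<^sup>* \<Longrightarrow> set w' = set w"
proof (induction rule: rtrancl_induct)
  case (step u v)
  have "set v = set u" using step.hyps(2) by (auto simp: ac_swap_def)
  with step.IH show ?case by simp
qed simp

lemma ac_swap_rtrancl_parikh_vector:
  assumes "distinct [a, b, c]" "(w, w') \<in> (ac_swap a c)\<^sup>*"
  shows "parikh_vector a b c w' = parikh_vector a b c w"
  using assms(2)
proof (induction rule: rtrancl_induct)
  case (step u v)
  \<comment> \<open>None of the six counted words has \<open>ac\<close> or \<open>ca\<close> as a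
    factor.\<close>
  have "parikh_vector a b c (x @ a # c # y) = parikh_vector a b c (x @ c # a # y)" for x y
    using assms(1) by (auto simp: parikh_vector_def subword_count_swap[of a c] sublist_Cons_right)
  with step show ?case by (auto simp: ac_swap_def)
qed simp

definition robust :: "'a \<Rightarrow> 'a \<Rightarrow> 'a list \<Rightarrow> bool" where
  "robust a c w \<longleftrightarrow> (\<forall>w'. (w, w') \<in> (ac_swap a c)\<^sup>* \<longrightarrow> square_free w')"

lemma robust_swap: "robust a c w \<Longrightarrow> (w, w') \<in> (ac_swap a c)\<^sup>* \<Longrightarrow> robust a c w'"
  unfolding robust_def by (meson rtrancl_trans)

text \<open>Swaps inside a factor are swaps of the whole word, and a square in the factor is a
  square in the whole word.\<close>

lemma robust_sublist:
  assumes "robust a c w" "sublist v w"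
  shows "robust a c v"
  unfolding robust_def
proof (intro allI impI)
  fix v' assume v': "(v, v') \<in> (ac_swap a c)\<^sup>*"
  obtain p s where "w = p @ v @ s" using assms(2) by (auto simp: sublist_def)
  then have "square_free (p @ v' @ s)"
    using assms(1) ac_swap_rtrancl_context[OF v'] by (auto simp: robust_def)
  moreover have "sublist v' (p @ v' @ s)" by (auto simp: sublist_def)
  ultimately show "square_free v'"
    unfolding square_free_def by (meson sublist_order.order_trans)
qed

subsection \<open>The sorted robust words\<close>

definition normal_forms :: "'a \<Rightarrow> 'a \<Rightarrow> 'a \<Rightarrow> 'a list list" where
  "normal_forms a b c = [[],
     [a], [b], [c],
     [a, b], [a, c], [b, a], [b, c], [c, b],
     [a, b, a], [a, b, c], [a, c, b], [b, a, b], [b, a, c], [b, c, b], [c, b, a], [c, b, c],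
     [a, b, a, c], [a, b, c, b], [a, c, b, a], [a, c, b, c], [b, a, b, c], [b, a, c, b],
     [b, c, b, a], [c, b, a, b], [c, b, a, c],
     [a, b, a, c, b], [a, b, c, b, a], [a, c, b, a, c], [b, a, b, c, b], [b, a, c, b, a],
     [b, a, c, b, c], [b, c, b, a, b], [c, b, a, b, c], [c, b, a, c, b],
     [a, b, a, c, b, a], [a, b, c, b, a, b], [b, a, b, c, b, a], [b, c, b, a, b, c],
     [c, b, a, b, c, b], [c, b, a, c, b, c],
     [a, b, c, b, a, b, c], [b, a, b, c, b, a, b], [b, c, b, a, b, c, b],
     [c, b, a, b, c, b, a]]"

text \<open>The squares of these roots contain no factor \<open>ca\<close>, since they are looked
  for only in sorted words.\<close>

definition square_roots :: "'a \<Rightarrow> 'a \<Rightarrow> 'a \<Rightarrow> 'a list list" where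
  "square_roots a b c = [[a], [b], [c], [a, b], [b, a], [b, c], [c, b],
     [a, c, b], [b, a, c], [c, b, a],
     [a, b, c, b], [b, a, b, c], [b, c, b, a], [c, b, a, b]]"

text \<open>Three obstructions are not squares themselves: \<open>acbab\<close>, \<open>bcbac\<close> and \<open>abacbc\<close> become
  \<open>c(ab)(ab)\<close>, \<open>(bc)(bc)a\<close> and \<open>(abc)(abc)\<close> after one swap.\<close>

definition obstructions :: "'a \<Rightarrow> 'a \<Rightarrow> 'a \<Rightarrow> 'a list list" where
  "obstructions a b c =
     [[a, c, b, a, b], [b, c, b, a, c], [a, b, a, c, b, c]] @
     map (\<lambda>u. u @ u) (square_roots a b c)"

lemma not_robust_obstruction:
  assumes "v \<in> set (obstructions a b c)"
  shows "\<not> robust a c v"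
proof -
  have sq: "\<not> square_free (p @ (u @ u) @ s)" if "u \<noteq> []" for p u s :: "'a list"
    using that by (auto simp: square_free_def sublist_def)
  have swap: "\<not> robust a c (p @ [a, c] @ s)" if "\<not> square_free (p @ [c, a] @ s)" for p s
    using that ac_swap_rtrancl_sym[OF ca_swap[of p c a s]] unfolding robust_def by blast
  have roots: "u \<noteq> []" if "u \<in> set (square_roots a b c)" for u
    using that by (auto simp: square_roots_def)
  \<comment> \<open>The three special words are split around the \<open>ac\<close> whose swap
    produces a square.\<close>
  from assms consider "v = [] @ [a, c] @ [b, a, b]" | "v = [b, c, b] @ [a, c] @ []"
    | "v = [a, b] @ [a, c] @ [b, c]" | u where "u \<in> set (square_roots a b c)" "v = u @ u"
    by (auto simp: obstructions_def)
  then show ?thesis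
  proof cases
    case 1
    then show ?thesis using swap[of "[]" "[b, a, b]"] sq[of "[a, b]" "[c]" "[]"] by simp
  next
    case 2
    then show ?thesis using swap[of "[b, c, b]" "[]"] sq[of "[b, c]" "[]" "[a]"] by simp
  next
    case 3
    then show ?thesis using swap[of "[a, b]" "[b, c]"] sq[of "[a, b, c]" "[]" "[]"] by simp
  next
    case 4
    then show ?thesis using sq[of u "[]" "[]"] roots by (auto simp: robust_def)
  qed
qed

text \<open>One exchange restores sortedness unless \<open>u\<close> ends in \<open>cc\<close>, and
  no normal form does.\<close>

definition append_sorted :: "'a \<Rightarrow> 'a \<Rightarrow> 'a list \<Rightarrow> 'a \<Rightarrow> 'a list" where
  "append_sorted a c u x =
     (if x = a \<and> u \<noteq> [] \<and> last u = c then butlast u @ [a, c] else u @ [x])"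

lemma append_sorted_swap: "(u @ [x], append_sorted a c u x) \<in> (ac_swap a c)\<^sup>*"
proof (cases "x = a \<and> u \<noteq> [] \<and> last u = c")
  case True
  then have "u @ [x] = butlast u @ [c, a] @ []"
    by (metis append_butlast_last_id append_Cons append_Nil append_Nil2 append_assoc)
  moreover have "append_sorted a c u x = butlast u @ [a, c] @ []"
    using True by (simp add: append_sorted_def)
  ultimately show ?thesis by (simp only: ca_swap)
qed (auto simp: append_sorted_def)

text \<open>A finite check of 45 words times 3 letters: every extension that leaves the list
  contains an obstruction, so the list is closed under robust extension.\<close>

lemma append_sorted_normal_forms:
  assumes "distinct [a, b, c]" "u \<in> set (normal_forms a b c)" "x \<in> {a, b, c}"
  shows "append_sorted a c u x \<in> set (normal_forms a b c) \<or>
    (\<exists>v \<in> set (obstructions a b c). sublist v (append_sorted a c u x))"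
proof -
  \<comment> \<open>Both orientations of each disequality let the simplifier decide all comparisons
    of letters.\<close>
  have "a \<noteq> b" "b \<noteq> a" "a \<noteq> c" "c \<noteq> a" "b \<noteq> c" "c \<noteq> b" using assms(1) by auto
  then have "\<forall>u \<in> set (normal_forms a b c). \<forall>x \<in> {a, b, c}.
    append_sorted a c u x \<in> set (normal_forms a b c) \<or>
    (\<exists>v \<in> set (obstructions a b c). sublist v (append_sorted a c u x))"
    by (simp add: normal_forms_def obstructions_def square_roots_def append_sorted_def
      sublist_Cons_right)
  then show ?thesis using assms by blast
qed

text \<open>The word is built letter by letter from the left. Its prefixes are robust as factors,
  and swaps keep the extended normal form robust, so it cannot contain an obstruction.\<close>

lemma robust_normal_form:
  assumes "distinct [a, b, c]" "w \<in> lists {a, b, c}" "robust a c w"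
  shows "\<exists>u \<in> set (normal_forms a b c). (w, u) \<in> (ac_swap a c)\<^sup>*"
  using assms(2,3)
proof (induction w rule: rev_induct)
  case Nil
  have "[] \<in> set (normal_forms a b c)" by (simp add: normal_forms_def)
  then show ?case by blast
next
  case (snoc x w)
  have "sublist w (w @ [x])" by (auto simp: sublist_def)
  with snoc.prems(2) have "robust a c w" by (rule robust_sublist)
  with snoc.IH snoc.prems(1) obtain u
    where u: "u \<in> set (normal_forms a b c)" "(w, u) \<in> (ac_swap a c)\<^sup>*"
    by (auto simp: lists_eq_set)
  let ?v = "append_sorted a c u x"
  have "(w @ [x], u @ [x]) \<in> (ac_swap a c)\<^sup>*"
    using ac_swap_rtrancl_context[OF u(2), of "[]" "[x]"] by simp
  then have swaps: "(w @ [x], ?v) \<in> (ac_swap a c)\<^sup>*"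
    using append_sorted_swap by (rule rtrancl_trans)
  have "robust a c ?v" using snoc.prems(2) swaps by (rule robust_swap)
  then have "\<not> (\<exists>v \<in> set (obstructions a b c). sublist v ?v)"
    using not_robust_obstruction robust_sublist by metis
  moreover have "x \<in> {a, b, c}" using snoc.prems(1) by simp
  ultimately have "?v \<in> set (normal_forms a b c)"
    using append_sorted_normal_forms[OF assms(1) u(1)] by blast
  with swaps show ?case by blast
qed

text \<open>A finite computation with the recursion for \<open>subword_count\<close>. It serves to
  identify the normal forms reached from two M-equivalent words.\<close>

lemma inj_on_parikh_vector_normal_forms:
  assumes "distinct [a, b, c]"
  shows "inj_on (parikh_vector a b c) (set (normal_forms a b c))"
proof -
  have "a \<noteq> b" "b \<noteq> a" "a \<noteq> c" "c \<noteq> a" "b \<noteq> c" "c \<noteq> b" using assms by auto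
  then have "distinct (map (parikh_vector a b c) (normal_forms a b c))"
    by (simp add: normal_forms_def parikh_vector_def)
  then show ?thesis by (simp add: distinct_map)
qed

section \<open>Square-free M-equivalence classes\<close>

theorem theorem4p3:
  fixes \<Sigma> :: "'a::linorder set" and a b c :: 'a
  assumes "\<Sigma> = {a, b, c}" and "a < b" and "b < c"
  shows "finite {K \<in> lists \<Sigma> // M_equiv a b c. \<forall>w\<in>K. square_free w} \<and>
    (\<forall>K \<in> lists \<Sigma> // M_equiv a b c.
       (\<forall>w\<in>K. square_free w) \<longrightarrow> K \<in> lists \<Sigma> // one_equiv a b c)"
proof -
  let ?M = "M_equiv a b c" and ?N = "set (normal_forms a b c)" and ?S = "(ac_swap a c)\<^sup>*"
  have dist: "distinct [a, b, c]" using assms by auto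
  have M_iff: "(w, w') \<in> ?M \<longleftrightarrow> w \<in> lists \<Sigma> \<and> w' \<in> lists \<Sigma> \<and>
      parikh_vector a b c w = parikh_vector a b c w'" for w w'
    by (simp add: M_equiv_def parikh_matrix_eq_iff assms(1))
  \<comment> \<open>Thus 1-equivalence refines M-equivalence, and M-classes are closed under
    swaps.\<close>
  have swap_M: "(w, w') \<in> ?M" if "w \<in> lists \<Sigma>" "(w, w') \<in> ?S" for w w'
    using that ac_swap_rtrancl_set[OF that(2)] ac_swap_rtrancl_parikh_vector[OF dist that(2)]
    by (simp add: M_iff lists_eq_set)
  \<comment> \<open>A single normal form represents the class for both relations: the first equation
    yields finiteness, the second the claim on 1-equivalence.\<close>
  have class_normal_form: "\<exists>u \<in> ?N. K = ?M `` {u} \<and> K = one_equiv a b c `` {u} \<and> u \<in> lists \<Sigma>"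
    if K: "K \<in> lists \<Sigma> // ?M" "\<forall>w\<in>K. square_free w" for K
  proof -
    obtain w where w: "w \<in> lists \<Sigma>" "K = ?M `` {w}" using K(1) by (rule quotientE)
    have normal: "\<exists>u \<in> ?N. (w', u) \<in> ?S" if "w' \<in> K" for w'
    proof -
      have w': "(w, w') \<in> ?M" using that w(2) by simp
      have "robust a c w'"
        unfolding robust_def
      proof (intro allI impI)
        fix v assume "(w', v) \<in> ?S"
        then have "(w', v) \<in> ?M" using w' swap_M M_iff by blast
        then have "v \<in> K" using w' w(2) M_iff by auto
        then show "square_free v" using K(2) by blast
      qed
      then show ?thesis using robust_normal_form[OF dist, of w'] w' M_iff assms(1) by auto
    qed
    have "w \<in> K" using w M_iff by auto
    then obtain u where u: "u \<in> ?N" "(w, u) \<in> ?S" using normal by blast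
    have wu: "(w, u) \<in> ?M" using swap_M[OF w(1) u(2)] .
    have K_u: "K = ?M `` {u}" using wu w(2) M_iff by auto
    \<comment> \<open>The normal form \<open>u'\<close> of \<open>w'\<close> lies in the same
      M-class as \<open>u\<close>, so injectivity gives \<open>u = u'\<close>, and reversing the
      swaps leads from \<open>u\<close> to \<open>w'\<close>.\<close>
    have "(u, w') \<in> ?S" if w': "w' \<in> K" for w'
    proof -
      obtain u' where u': "u' \<in> ?N" "(w', u') \<in> ?S" using normal[OF w'] by blast
      have uw': "(u, w') \<in> ?M" using w' K_u by simp
      then have "(w', u') \<in> ?M" using swap_M u'(2) M_iff by blast
      with uw' have "parikh_vector a b c u = parikh_vector a b c u'" by (simp add: M_iff)
      then have "u = u'"
        using inj_on_parikh_vector_normal_forms[OF dist] u(1) u'(1) by (auto dest: inj_onD)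
      then show ?thesis using u'(2) ac_swap_rtrancl_sym by auto
    qed
    then have "w' \<in> K \<longleftrightarrow> (u, w') \<in> one_equiv a b c" for w'
      using K_u swap_M[of u w'] wu M_iff unfolding one_equiv_def assms(1) by blast
    then have "K = one_equiv a b c `` {u}" by blast
    then show ?thesis using u(1) K_u wu M_iff by blast
  qed
  \<comment> \<open>Each such class is determined by its normal form, so there are at most
    45.\<close>
  have "{K \<in> lists \<Sigma> // ?M. \<forall>w\<in>K. square_free w} \<subseteq> (\<lambda>u. ?M `` {u}) ` ?N"
    using class_normal_form by blast
  then have "finite {K \<in> lists \<Sigma> // ?M. \<forall>w\<in>K. square_free w}"
    by (rule finite_subset) simp
  moreover have "K \<in> lists \<Sigma> // one_equiv a b c"
    if "K \<in> lists \<Sigma> // ?M" "\<forall>w\<in>K. square_free w" for K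
    using class_normal_form[OF that] by (auto intro: quotientI)
  ultimately show ?thesis by blast
qed

end
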